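(* Let $\{X_i\}_{i\in\mathbf N}$ be a family of finite connected graphs with uniformly bounded vertex degrees and with large girth, such that every vertex of every $X_i$ has degree at least $2$. Then the coarse disjoint union $X=\bigsqcup_{i\in\mathbf N}X_i$ is fibredly coarsely amenable.
   Context: Graphs are regarded as metric spaces: their vertex sets with the graph (path) metric. The girth $g(X)$ of a graph $X$ is the length of its smallest simple cycle; a family $\{X_i\}_{i\in\mathbf N}$ has large girth if $g(X_i)\to\infty$ as $i\to\infty$. The coarse disjoint union of a family of finite metric spaces $\{X_i\}$ is $\bigsqcup_i X_i$ with the metric $d(x,y)=d_{X_i}(x,y)$ if $x,y\in X_i$, and $d(x,y)=\max(\operatorname{diam}(X_i),\operatorname{diam}(X_j))+1$ if $x\in X_i$, $y\in X_j$, $i\ne j$. A metric space $X$ is uniformly discrete if there is $\varepsilon>0$ such that $d(x,y)<\varepsilon$ implies $x=y$; it has bounded geometry if for every $R\ge 0$ there is a uniform bound on the cardinality of balls of radius $R$. $B_x(R)$ denotes the closed ball of radius $R$ centred at $x$. Fibred coarse amenability. Let $X$ be a uniformly discrete metric space of bounded geometry. For a function $\xi:X\to\ell^\infty(\mathbf N)$, $z\mapsto\xi_z$, of finite support put $\|\xi\|_u=\big\|\sum_{z\in X}|\xi_z|\big\|_\infty$. Such a $\xi$ is an $\ell^\infty(\mathbf N)$-valued probability measure if $\xi_z\ge 0$ pointwise for all $z$ and $\sum_{z\in X}\xi_z\equiv 1$. $X$ is fibred (or fibredly) coarsely amenable if there is a field of Banach spaces $(\ell^\infty_x)_{x\in X}$,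 each $\ell^\infty_x$ being a copy of $\ell^\infty(\mathbf N)$, such that for all $R,\varepsilon>0$ there exist $S_0\ge 0$ and functions $\xi^x:X\to\ell^\infty_x$ $(x\in X)$ satisfying: (i) $\operatorname{Supp}(\xi^x)\subset B_x(S_0)$; (ii) $\xi^x$ is an $\ell^\infty_x$-valued probability measure for every $x\in X$; and such that for every $L\ge 0$ there is a finite subset $K_L\subset X$ such that for every finite subset $C\subset X\setminus K_L$ of diameter at most $L$ there is a trivialisation $t_C:\bigsqcup_{x\in C}\ell^\infty_x\to C\times\ell^\infty(\mathbf N)$, with restrictions $t_C(x):=t_C|_{\ell^\infty_x}:\ell^\infty_x\to\ell^\infty(\mathbf N)$, satisfying: (iii) for all $x\in C$, $t_C(x)$ is an invertible linear isometry induced by a permutation of the index set $\mathbf N$; (iv) for all $x,y\in C$ with $d(x,y)\le R$, $\|t_C(x)\xi^x-t_C(y)\xi^y\|_u\le\varepsilon$, where $(t_C(x)\xi^x)_z=t_C(x)(\xi^x_z)$ for $z\in X$; (v) for all finite $C_1,C_2\subset X\setminus K_L$ of diameter at most $L$, the isometry $t_{C_1}(x)\circ t_{C_2}(x)^{-1}$ of $\ell^\infty(\mathbf N)$ does not depend on $x\in C_1\cap C_2$. *)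

theory Defs
  imports "HOL-Analysis.Analysis" "Graph_Theory.Digraph_Component"
begin

section \<open>Graphs as metric spaces, and girth\<close>

text \<open>
  A finite simple undirected graph is a \<^locale>\<open>graph\<close> of the library: a finite symmetric
  digraph without loops and parallel arcs, each edge being a pair of opposite arcs. Hence the
  degree of a vertex is its out-degree, and the simple cycles of the undirected graph are the
  directed cycles of length at least 3 (going along an edge and back is a directed cycle of
  length 2).
\<close>

definition girth :: "('a, 'b) pre_digraph \<Rightarrow> enat" where
  "girth G = (INF p \<in> {p. pre_digraph.cycle G p \<and> 3 \<le> length p}. enat (length p))"

definition graph_dist :: "('a, 'b) pre_digraph \<Rightarrow> 'a \<Rightarrow> 'a \<Rightarrow> real" where
  "graph_dist G u v = real (LEAST n. \<exists>p. pre_digraph.awalk G u p v \<and> length p = n)"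

definition graph_metric :: "('a, 'b) pre_digraph \<Rightarrow> 'a metric" where
  "graph_metric G = metric (verts G, graph_dist G)"

text \<open>The type \<^typ>\<open>'a metric\<close> is inhabited only by metric spaces; the definition above is
  meaningful for connected graphs, as the following facts show.\<close>

lemma (in sym_digraph) awalk_reverse:
  assumes "awalk u p v"
  shows "\<exists>q. awalk v q u \<and> length q = length p"
  using assms
proof (induction p arbitrary: u)
  case Nil
  then show ?case by (auto simp: awalk_def)
next
  case (Cons e p)
  then have e: "e \<in> arcs G" "tail G e = u" and p: "awalk (head G e) p v"
    by (auto simp: awalk_Cons_iff)
  from Cons.IH[OF p] obtain q where q: "awalk v q (head G e)" "length q = length p" by blast
  have "(tail G e, head G e) \<in> arcs_ends G"
    using e by (auto simp: arcs_ends_def arc_to_ends_def)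
  then have "(head G e, tail G e) \<in> arcs_ends G"
    using sym_arcs by (auto simp: symmetric_def dest: symD)
  then obtain e' where e': "e' \<in> arcs G" "tail G e' = head G e" "head G e' = u"
    using e by (auto simp: arcs_ends_def arc_to_ends_def)
  have "awalk (head G e) [e'] u"
    using e' by (auto simp: awalk_Cons_iff awalk_Nil_iff)
  with q have "awalk v (q @ [e']) u" by (metis awalk_appendI)
  with q show ?case by (intro exI[of _ "q @ [e']"]) simp
qed

lemma graph_awalk_exists:
  assumes "graph G" "Digraph_Component.connected G" "u \<in> verts G" "v \<in> verts G"
  shows "\<exists>p. pre_digraph.awalk G u p v"
proof -
  interpret graph G by fact
  have "u \<rightarrow>\<^sup>*\<^bsub>with_proj (mk_symmetric G)\<^esub> v"
    using assms unfolding Digraph_Component.connected_def strongly_connected_def by auto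
  then have "u \<rightarrow>\<^sup>*\<^bsub>G\<^esub> v"
    using reachable_mk_symmetric_eq by blast
  then show ?thesis by (simp add: reachable_awalk)
qed

lemma graph_dist_awalk:
  assumes "graph G" "Digraph_Component.connected G" "u \<in> verts G" "v \<in> verts G"
  obtains p where "pre_digraph.awalk G u p v" "graph_dist G u v = real (length p)"
proof -
  obtain p0 where "pre_digraph.awalk G u p0 v" using graph_awalk_exists[OF assms] by blast
  then have "\<exists>n p. pre_digraph.awalk G u p v \<and> length p = n" by blast
  from LeastI_ex[OF this] show ?thesis
    using that unfolding graph_dist_def by auto
qed

lemma graph_dist_le:
  assumes "pre_digraph.awalk G u p v"
  shows "graph_dist G u v \<le> real (length p)"
  unfolding graph_dist_def using assms by (auto intro!: Least_le)

lemma Metric_space_graph_dist: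
  assumes "graph G" "Digraph_Component.connected G"
  shows "Metric_space (verts G) (graph_dist G)"
proof -
  interpret graph G by fact
  show ?thesis
  proof
    show "0 \<le> graph_dist G x y" for x y by (simp add: graph_dist_def)
    show "graph_dist G x y = graph_dist G y x" for x y
    proof -
      have "(\<exists>p. awalk x p y \<and> length p = n) \<longleftrightarrow> (\<exists>p. awalk y p x \<and> length p = n)" for n
        using awalk_reverse by metis
      then show ?thesis by (simp add: graph_dist_def)
    qed
    show "graph_dist G x y = 0 \<longleftrightarrow> x = y" if xy: "x \<in> verts G" "y \<in> verts G" for x y
    proof
      assume "graph_dist G x y = 0"
      moreover obtain p where "awalk x p y" "graph_dist G x y = real (length p)"
        using graph_dist_awalk[OF assms xy] .
      ultimately show "x = y" by (auto simp: awalk_Nil_iff)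
    next
      assume "x = y"
      then have "awalk x [] y" using xy by (simp add: awalk_Nil_iff)
      from graph_dist_le[OF this] show "graph_dist G x y = 0" by (simp add: graph_dist_def)
    qed
    show "graph_dist G x z \<le> graph_dist G x y + graph_dist G y z"
      if xyz: "x \<in> verts G" "y \<in> verts G" "z \<in> verts G" for x y z
    proof -
      obtain p where p: "awalk x p y" "graph_dist G x y = real (length p)"
        using graph_dist_awalk[OF assms xyz(1,2)] .
      obtain q where q: "awalk y q z" "graph_dist G y z = real (length q)"
        using graph_dist_awalk[OF assms xyz(2,3)] .
      have "awalk x (p @ q) z" using p q by (metis awalk_appendI)
      from graph_dist_le[OF this] show ?thesis using p q by simp
    qed
  qed
qed

lemma
  assumes "graph G" "Digraph_Component.connected G"
  shows mspace_graph_metric: "mspace (graph_metric G) = verts G"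
    and mdist_graph_metric: "mdist (graph_metric G) = graph_dist G"
  using Metric_space.mspace_metric[OF Metric_space_graph_dist[OF assms]]
    Metric_space.mdist_metric[OF Metric_space_graph_dist[OF assms]]
  by (simp_all add: graph_metric_def)


section \<open>Coarse disjoint unions\<close>

definition mdiam :: "'a metric \<Rightarrow> 'a set \<Rightarrow> real" where
  "mdiam X C = (if C = {} then 0 else SUP (x, y) \<in> C \<times> C. mdist X x y)"

definition coarse_union_dist :: "(nat \<Rightarrow> 'a metric) \<Rightarrow> nat \<times> 'a \<Rightarrow> nat \<times> 'a \<Rightarrow> real" where
  "coarse_union_dist X = (\<lambda>(i, x) (j, y).
     if i = j then mdist (X i) x y
     else max (mdiam (X i) (mspace (X i))) (mdiam (X j) (mspace (X j))) + 1)"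

definition coarse_union :: "(nat \<Rightarrow> 'a metric) \<Rightarrow> (nat \<times> 'a) metric" where
  "coarse_union X = metric (SIGMA i:UNIV. mspace (X i), coarse_union_dist X)"

lemma mdist_le_mdiam:
  assumes "finite C" "x \<in> C" "y \<in> C"
  shows "mdist X x y \<le> mdiam X C"
proof -
  have "(case (x, y) of (x, y) \<Rightarrow> mdist X x y) \<le> (SUP (x, y) \<in> C \<times> C. mdist X x y)"
    by (rule cSUP_upper) (use assms in \<open>auto intro!: bdd_above_finite\<close>)
  then show ?thesis using assms by (auto simp: mdiam_def)
qed

lemma mdiam_nonneg:
  assumes "finite C"
  shows "0 \<le> mdiam X C"
proof (cases "C = {}")
  case False
  then obtain x where "x \<in> C" by blast
  then show ?thesis using mdist_le_mdiam[OF assms, of x x X] mdist_nonneg[of X x x] by linarith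
qed (simp add: mdiam_def)

lemma Metric_space_coarse_union:
  assumes fin: "\<And>i. finite (mspace (X i))"
  shows "Metric_space (SIGMA i:UNIV. mspace (X i)) (coarse_union_dist X)"
proof -
  let ?D = "\<lambda>i. mdiam (X i) (mspace (X i))"
  have D0: "0 \<le> ?D i" for i using mdiam_nonneg[OF fin] .
  have le: "mdist (X i) x y \<le> ?D i" if "x \<in> mspace (X i)" "y \<in> mspace (X i)" for i x y
    using mdist_le_mdiam[OF fin that] .
  have n: "0 \<le> max (?D i) (?D j)" for i j using D0[of i] by linarith
  show ?thesis
  proof
    show "0 \<le> coarse_union_dist X a b" for a b
      using n[of "fst a" "fst b"] by (cases a; cases b) (auto simp: coarse_union_dist_def)
    show "coarse_union_dist X a b = coarse_union_dist X b a" for a b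
      by (cases a; cases b) (auto simp: coarse_union_dist_def mdist_commute max.commute)
    show "coarse_union_dist X a b = 0 \<longleftrightarrow> a = b"
      if "a \<in> (SIGMA i:UNIV. mspace (X i))" "b \<in> (SIGMA i:UNIV. mspace (X i))" for a b
      using that n[of "fst a" "fst b"]
      by (cases a; cases b) (auto simp: coarse_union_dist_def)
    show "coarse_union_dist X a c \<le> coarse_union_dist X a b + coarse_union_dist X b c"
      if abc: "a \<in> (SIGMA i:UNIV. mspace (X i))" "b \<in> (SIGMA i:UNIV. mspace (X i))"
        "c \<in> (SIGMA i:UNIV. mspace (X i))" for a b c
    proof -
      obtain i x j y k z where [simp]: "a = (i, x)" "b = (j, y)" "c = (k, z)"
        by (cases a; cases b; cases c)
      have xyz: "x \<in> mspace (X i)" "y \<in> mspace (X j)" "z \<in> mspace (X k)"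
        using abc by auto
      consider "i = j" "j = k" | "i = j" "j \<noteq> k" | "i \<noteq> j" "j = k" | "i \<noteq> j" "j \<noteq> k" "i = k"
        | "i \<noteq> j" "j \<noteq> k" "i \<noteq> k" by blast
      then show ?thesis
      proof cases
        case 1
        then show ?thesis using mdist_triangle[of x "X i" y z] xyz by (auto simp add: coarse_union_dist_def)
      next
        case 4
        then show ?thesis
          using le[of x i z] D0[of i] xyz by (auto simp: coarse_union_dist_def)
      qed (use xyz D0[of i] D0[of j] D0[of k] in \<open>auto simp: coarse_union_dist_def\<close>)
    qed
  qed
qed

lemma
  assumes "\<And>i. finite (mspace (X i))"
  shows mspace_coarse_union: "mspace (coarse_union X) = (SIGMA i:UNIV. mspace (X i))"
    and mdist_coarse_union: "mdist (coarse_union X) = coarse_union_dist X"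
  using Metric_space.mspace_metric[OF Metric_space_coarse_union[OF assms]]
    Metric_space.mdist_metric[OF Metric_space_coarse_union[OF assms]]
  by (simp_all add: coarse_union_def)


section \<open>Fibred coarse amenability\<close>

definition uniformly_discrete :: "'a metric \<Rightarrow> bool" where
  "uniformly_discrete X \<longleftrightarrow>
     (\<exists>\<epsilon>>0. \<forall>x\<in>mspace X. \<forall>y\<in>mspace X. mdist X x y < \<epsilon> \<longrightarrow> x = y)"

definition bounded_geometry :: "'a metric \<Rightarrow> bool" where
  "bounded_geometry X \<longleftrightarrow>
     (\<forall>R\<ge>0. \<exists>N. \<forall>x\<in>mspace X. finite (mcball_of X x R) \<and> card (mcball_of X x R) \<le> N)"

text \<open>As \<^typ>\<open>nat\<close> is discrete, the bounded continuous functions on it are all bounded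
  sequences, and their norm is the supremum norm.\<close>

type_synonym linf = "nat \<Rightarrow>\<^sub>C real"

definition linf_abs :: "linf \<Rightarrow> linf" where
  "linf_abs f = Bcontfun (\<lambda>n. \<bar>apply_bcontfun f n\<bar>)"

lemma apply_linf_abs: "apply_bcontfun (linf_abs f) n = \<bar>apply_bcontfun f n\<bar>"
proof -
  have "(\<lambda>n. \<bar>apply_bcontfun f n\<bar>) \<in> bcontfun"
    using norm_bounded[of f] by (intro bcontfun_normI[where b = "norm f"]) auto
  then show ?thesis by (simp add: linf_abs_def Bcontfun_inverse)
qed

definition linf_support :: "'a metric \<Rightarrow> ('a \<Rightarrow> linf) \<Rightarrow> 'a set" where
  "linf_support X \<xi> = {z \<in> mspace X. \<xi> z \<noteq> 0}"

definition norm_u :: "'a metric \<Rightarrow> ('a \<Rightarrow> linf) \<Rightarrow> real" where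
  "norm_u X \<xi> = norm (\<Sum>z\<in>linf_support X \<xi>. linf_abs (\<xi> z))"

definition linf_prob :: "'a metric \<Rightarrow> ('a \<Rightarrow> linf) \<Rightarrow> bool" where
  "linf_prob X \<xi> \<longleftrightarrow> finite (linf_support X \<xi>)
     \<and> (\<forall>z\<in>mspace X. \<forall>n. 0 \<le> apply_bcontfun (\<xi> z) n)
     \<and> (\<Sum>z\<in>linf_support X \<xi>. \<xi> z) = const_bcontfun 1"

definition perm_isometry :: "(linf \<Rightarrow> linf) \<Rightarrow> bool" where
  "perm_isometry T \<longleftrightarrow> linear T \<and> bij T \<and> (\<forall>f. norm (T f) = norm f)
     \<and> (\<exists>\<sigma>. bij \<sigma> \<and> (\<forall>f n. apply_bcontfun (T f) n = apply_bcontfun f (\<sigma> n)))"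

definition sets_off :: "'a metric \<Rightarrow> 'a set \<Rightarrow> real \<Rightarrow> 'a set set" where
  "sets_off X K L = {C. finite C \<and> C \<subseteq> mspace X - K \<and> mdiam X C \<le> L}"

text \<open>
  Every fibre of the field of Banach spaces is a copy of \<^typ>\<open>linf\<close>, so the field itself is the
  constant one and carries no data. A trivialisation over \<open>C\<close> is given by its restrictions
  \<open>t C x\<close> to the fibres over the points \<open>x \<in> C\<close>; the values \<open>t C x\<close> for other \<open>x\<close> are irrelevant,
  as are the values of \<open>\<xi> x\<close> outside of \<^term>\<open>mspace X\<close>.
\<close>

definition fibred_coarsely_amenable :: "'a metric \<Rightarrow> bool" where
  "fibred_coarsely_amenable X \<longleftrightarrow> uniformly_discrete X \<and> bounded_geometry X \<and>
     (\<forall>R>0. \<forall>\<epsilon>>0. \<exists>S\<ge>0. \<exists>\<xi> :: 'a \<Rightarrow> 'a \<Rightarrow> linf.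
        (\<forall>x\<in>mspace X. linf_support X (\<xi> x) \<subseteq> mcball_of X x S) \<and>
        (\<forall>x\<in>mspace X. linf_prob X (\<xi> x)) \<and>
        (\<forall>L\<ge>0. \<exists>K. finite K \<and> K \<subseteq> mspace X \<and>
          (\<exists>t :: 'a set \<Rightarrow> 'a \<Rightarrow> linf \<Rightarrow> linf.
            (\<forall>C\<in>sets_off X K L. \<forall>x\<in>C. perm_isometry (t C x)) \<and>
            (\<forall>C\<in>sets_off X K L. \<forall>x\<in>C. \<forall>y\<in>C. mdist X x y \<le> R \<longrightarrow>
               norm_u X (\<lambda>z. t C x (\<xi> x z) - t C y (\<xi> y z)) \<le> \<epsilon>) \<and>
            (\<forall>C\<^sub>1\<in>sets_off X K L. \<forall>C\<^sub>2\<in>sets_off X K L. \<forall>x\<in>C\<^sub>1 \<inter> C\<^sub>2. \<forall>y\<in>C\<^sub>1 \<inter> C\<^sub>2.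
               t C\<^sub>1 x \<circ> inv (t C\<^sub>2 x) = t C\<^sub>1 y \<circ> inv (t C\<^sub>2 y)))))"

end

theory Submission
  imports Defs
begin

text \<open>
  A coordinate \<open>n\<close> of the fibre over a vertex \<open>x\<close> stands for a list of \<open>S\<close> vertices whose
  \<open>k\<close>-th entry has distance at most \<open>k\<close> from \<open>x\<close>, an itinerary from \<open>x\<close>; every such list is
  represented by infinitely many coordinates. The \<open>n\<close>-th coordinate of the probability measure
  at \<open>x\<close> is the uniform distribution on the entries of the list, so the measure is supported in
  the ball of radius \<open>S\<close>.

  If \<open>y\<close> is adjacent to \<open>x\<close>, then putting \<open>y\<close> in front of an itinerary from \<open>x\<close> and deleting the
  last entry yields an itinerary from \<open>y\<close>, and this changes the occupation numbers by at most
  2 in \<open>l\<^sup>1\<close>-norm. The two operations, from \<open>x\<close> to \<open>y\<close> and from \<open>y\<close> to \<open>x\<close>, are not injective on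
  lists, but with infinitely many coordinates for each list they lift to injections between the
  coordinates. The proof of the Schroeder--Bernstein theorem glues these to a bijection of the
  coordinates of \<open>x\<close> with those of \<open>y\<close> which agrees, at each coordinate, with one operation or
  the other (\<open>itinerary_matching\<close>). Hence every edge carries a permutation of the natural
  numbers along which the measures of its ends differ by at most \<open>2 / S\<close>.

  Composing these permutations along walks is a parallel transport. Its holonomy around a closed
  walk shorter than the girth is trivial, since such a walk reduces to a point by deleting
  backtrackings (\<open>holonomy_short_closed_walk\<close>). A set of diameter at most \<open>L\<close> in a graph of girth
  more than \<open>3 L\<close> is trivialised by transport from a base point. Two points at distance at
  most \<open>R\<close> then have measures that differ by at most \<open>2 R / S\<close>, which is small for large \<open>S\<close>, and
  two trivialisations differ by the same permutation at every common point, because both change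
  from point to point by the same transport.

  It remains to see that distinct graphs are far apart in the coarse union. As all degrees are
  at least 2, every graph contains a cycle and so has at least as many vertices as its girth;
  as the degrees are bounded, the diameters therefore tend to infinity (\<open>finite_diam_le\<close>). This
  gives bounded geometry, and it places every set of diameter at most \<open>L\<close> that avoids finitely
  many of the graphs inside a single graph.
\<close>

section \<open>Bijections assembled from two injections\<close>

text \<open>
  Banach's refinement of the theorem of Schroeder and Bernstein: the bijection may be
  required to follow, at each point, one of the two given injections. Any relation respected by
  both injections is then respected by the bijection.
\<close>

lemma Schroeder_Bernstein_pointwise:
  fixes f :: "'c \<Rightarrow> 'd" and g :: "'d \<Rightarrow> 'c"
  assumes "inj f" "inj g"
  obtains h where "bij h" "\<And>n. h n = f n \<or> g (h n) = n"
proof -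
  \<comment> \<open>The points whose backward orbit under \<open>g\<close> and \<open>f\<close> stops outside the range of \<open>g\<close>.\<close>
  define X where "X = lfp (\<lambda>X. - g ` (- f ` X))"
  have "X = - g ` (- f ` X)"
    unfolding X_def by (rule lfp_unfold) (blast intro: monoI)
  then have co: "- X = g ` (- f ` X)" by auto
  define h where "h z = (if z \<in> X then f z else inv g z)" for z
  have 1: "bij_betw h X (f ` X)"
    using inj_on_subset[OF assms(1)] by (auto simp: bij_betw_def h_def inj_on_def)
  have 2: "bij_betw h (- X) (- f ` X)"
  proof -
    have "bij_betw (inv g) (g ` (- f ` X)) (- f ` X)"
      using assms(2) by (auto simp: bij_betw_def inj_on_def image_image)
    then show ?thesis
      unfolding co[symmetric] by (subst bij_betw_cong[of _ _ "inv g"]) (auto simp: h_def)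
  qed
  have "bij_betw h (X \<union> - X) (f ` X \<union> - f ` X)"
    by (rule bij_betw_combine[OF 1 2]) auto
  then have "bij h" by simp
  moreover have "h n = f n \<or> g (h n) = n" for n
  proof (cases "n \<in> X")
    case False
    then have "n \<in> g ` (- f ` X)" using co by blast
    then show ?thesis using False assms(2) by (auto simp: h_def)
  qed (simp add: h_def)
  ultimately show thesis using that by blast
qed


section \<open>Itineraries\<close>

text \<open>
  Consecutive entries need not be adjacent. Only the distance from the start matters, and this
  makes the family stable under prepending a neighbour of the start.
\<close>

definition itineraries :: "'a metric \<Rightarrow> nat \<Rightarrow> 'a \<Rightarrow> 'a list set" where
  "itineraries M S x =
     {p. length p = S \<and> (\<forall>k<S. p ! k \<in> mspace M \<and> mdist M x (p ! k) \<le> real k)}"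

text \<open>
  The second component of the decoded pair is ignored, so that every itinerary occurs at
  infinitely many indices.
\<close>

definition itinerary :: "'a metric \<Rightarrow> nat \<Rightarrow> 'a \<Rightarrow> nat \<Rightarrow> 'a list" where
  "itinerary M S x n = from_nat_into (itineraries M S x) (fst (prod_decode n))"

lemma countable_itineraries:
  assumes "countable (mspace M)"
  shows "countable (itineraries M S x)"
proof (rule countable_subset)
  show "itineraries M S x \<subseteq> lists (mspace M)"
    by (auto simp: itineraries_def in_set_conv_nth)
qed (use assms in auto)

lemma itinerary_in:
  assumes "x \<in> mspace M"
  shows "itinerary M S x n \<in> itineraries M S x"
proof -
  have "replicate S x \<in> itineraries M S x"
    using assms by (simp add: itineraries_def Metric_space.mdist_zero[OF Metric_space_mspace_mdist])
  then show ?thesis unfolding itinerary_def by (intro from_nat_into) auto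
qed

lemma itineraries_neighbour:
  assumes "x \<in> mspace M" "y \<in> mspace M" "mdist M x y \<le> 1" "p \<in> itineraries M S x"
    and "0 < S"
  shows "y # butlast p \<in> itineraries M S y"
proof -
  have "(y # butlast p) ! k \<in> mspace M \<and> mdist M y ((y # butlast p) ! k) \<le> real k"
    if k: "k < S" for k
  proof (cases k)
    case (Suc j)
    have p: "length p = S" "p ! j \<in> mspace M" "mdist M x (p ! j) \<le> real j"
      using assms(4) k Suc by (auto simp: itineraries_def)
    have "mdist M y (p ! j) \<le> mdist M y x + mdist M x (p ! j)"
      using assms p by (intro mdist_triangle) auto
    then show ?thesis using p k Suc assms(3) by (simp add: nth_butlast mdist_commute[of M y x])
  qed (use assms in \<open>simp add: Metric_space.mdist_zero[OF Metric_space_mspace_mdist]\<close>)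
  then show ?thesis using assms(4,5) by (simp add: itineraries_def)
qed

text \<open>Only the occupation numbers of the removed and of the added entry change.\<close>

lemma sum_count_list_butlast_le:
  assumes "finite Z" "p \<noteq> []"
  shows "(\<Sum>z\<in>Z. \<bar>real (count_list p z) - real (count_list (y # butlast p) z)\<bar>) \<le> 2"
proof -
  have "count_list p z = count_list (butlast p @ [last p]) z" for z
    using assms(2) by simp
  then have c: "count_list p z = count_list (butlast p) z + (if z = last p then 1 else 0)" for z
    by (simp del: append_butlast_last_id)
  have "(\<Sum>z\<in>Z. \<bar>real (count_list p z) - real (count_list (y # butlast p) z)\<bar>)
      \<le> (\<Sum>z\<in>Z. (if z = last p then 1 else 0) + (if z = y then 1 else 0))"
    by (rule sum_mono) (auto simp: c)
  also have "\<dots> \<le> 2" using assms(1) by (simp add: sum.distrib sum.delta)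
  finally show ?thesis .
qed

text \<open>
  The map \<open>p \<mapsto> y # butlast p\<close> on itineraries becomes injective on indices when the original
  index is stored in the component that \<^const>\<open>itinerary\<close> ignores. Both directions together
  yield a bijection by the pointwise form of the Schroeder--Bernstein theorem.
\<close>

lemma itinerary_matching:
  assumes "countable (mspace M)" "x \<in> mspace M" "y \<in> mspace M" "mdist M x y \<le> 1" "0 < S"
  obtains h where "bij h"
    "\<And>n Z. finite Z \<Longrightarrow> (\<Sum>z\<in>Z. \<bar>real (count_list (itinerary M S x n) z)
                            - real (count_list (itinerary M S y (h n)) z)\<bar>) \<le> 2"
proof -
  have one: "\<exists>f. inj f \<and> (\<forall>n. itinerary M S v (f n) = v # butlast (itinerary M S u n))"
    if uv: "u \<in> mspace M" "v \<in> mspace M" "mdist M u v \<le> 1" for u v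
  proof -
    define f where "f n = prod_encode (to_nat_on (itineraries M S v) (v # butlast (itinerary M S u n)), n)" for n
    have "inj f" by (auto simp: f_def inj_on_def)
    moreover have "itinerary M S v (f n) = v # butlast (itinerary M S u n)" for n
    proof -
      have "v # butlast (itinerary M S u n) \<in> itineraries M S v"
        using itineraries_neighbour[OF uv itinerary_in[OF uv(1)] assms(5)] .
      then show ?thesis
        using countable_itineraries[OF assms(1)] by (simp add: itinerary_def[of M S v] f_def)
    qed
    ultimately show ?thesis by blast
  qed
  obtain f where f: "inj f" "\<And>n. itinerary M S y (f n) = y # butlast (itinerary M S x n)"
    using one[OF assms(2-4)] by blast
  obtain g where g: "inj g" "\<And>n. itinerary M S x (g n) = x # butlast (itinerary M S y n)"
    using one[OF assms(3,2)] assms(4) by (auto simp: mdist_commute)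
  obtain h where h: "bij h" "\<And>n. h n = f n \<or> g (h n) = n"
    using Schroeder_Bernstein_pointwise[OF f(1) g(1)] by blast
  have ne: "itinerary M S x n \<noteq> []" "itinerary M S y n \<noteq> []" for n
    using itinerary_in[OF assms(2), of S n] itinerary_in[OF assms(3), of S n] assms(5)
    by (auto simp: itineraries_def)
  have "(\<Sum>z\<in>Z. \<bar>real (count_list (itinerary M S x n) z)
           - real (count_list (itinerary M S y (h n)) z)\<bar>) \<le> 2" if "finite Z" for n Z
    using h(2)[of n]
  proof
    assume "h n = f n"
    then show ?thesis using sum_count_list_butlast_le[OF that ne(1)[of n], of y] f(2) by simp
  next
    assume "g (h n) = n"
    then have "itinerary M S x n = x # butlast (itinerary M S y (h n))" using g(2) by metis
    then show ?thesis
      using sum_count_list_butlast_le[OF that ne(2)[of "h n"], of x]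
      by (simp add: abs_minus_commute)
  qed
  with h(1) show thesis using that by blast
qed

text \<open>
  The matchings for the two orientations of an edge can be chosen inverse to each other: an
  enumeration of the space singles out one orientation, and the other one gets the inverse.
\<close>

lemma itinerary_transport:
  assumes "countable (mspace M)" "0 < S"
  obtains \<tau> where
    "\<And>x y. x \<in> mspace M \<Longrightarrow> y \<in> mspace M \<Longrightarrow> mdist M x y \<le> 1 \<Longrightarrow> bij (\<tau> x y)"
    "\<And>x y. x \<in> mspace M \<Longrightarrow> y \<in> mspace M \<Longrightarrow> mdist M x y \<le> 1 \<Longrightarrow> \<tau> y x \<circ> \<tau> x y = id"
    "\<And>x y n Z. x \<in> mspace M \<Longrightarrow> y \<in> mspace M \<Longrightarrow> mdist M x y \<le> 1 \<Longrightarrow> finite Z \<Longrightarrow>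
       (\<Sum>z\<in>Z. \<bar>real (count_list (itinerary M S x n) z)
             - real (count_list (itinerary M S y (\<tau> x y n)) z)\<bar>) \<le> 2"
proof -
  define ok where "ok x y h \<longleftrightarrow> bij h \<and> (\<forall>n Z. finite Z \<longrightarrow>
       (\<Sum>z\<in>Z. \<bar>real (count_list (itinerary M S x n) z)
             - real (count_list (itinerary M S y (h n)) z)\<bar>) \<le> 2)" for x y h
  define good where "good x y \<longleftrightarrow> x \<in> mspace M \<and> y \<in> mspace M \<and> mdist M x y \<le> 1" for x y
  have "\<exists>h. ok x y h" if "good x y" for x y
    using itinerary_matching[OF assms(1) _ _ _ assms(2), of x y] that
    unfolding ok_def good_def by metis
  then obtain \<tau>0 where \<tau>0: "\<And>x y. good x y \<Longrightarrow> ok x y (\<tau>0 x y)" by metis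
  define idx where "idx = to_nat_on (mspace M)"
  define \<tau> where "\<tau> x y = (if idx x < idx y then \<tau>0 x y
     else if idx y < idx x then inv (\<tau>0 y x) else id)" for x y
  have sym: "good y x" if "good x y" for x y
    using that by (simp add: good_def mdist_commute)
  have ok_inv: "ok y x (inv h)" if "ok x y h" for x y h
  proof -
    have "bij h" and h: "\<And>n Z. finite Z \<Longrightarrow>
       (\<Sum>z\<in>Z. \<bar>real (count_list (itinerary M S x n) z)
             - real (count_list (itinerary M S y (h n)) z)\<bar>) \<le> 2"
      using that by (auto simp: ok_def)
    have "(\<Sum>z\<in>Z. \<bar>real (count_list (itinerary M S y n) z)
             - real (count_list (itinerary M S x (inv h n)) z)\<bar>) \<le> 2" if "finite Z" for n Z
      using h[OF that, of "inv h n"] \<open>bij h\<close>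
      by (simp add: abs_minus_commute surj_f_inv_f bij_is_surj)
    then show ?thesis using \<open>bij h\<close> by (auto simp: ok_def bij_imp_bij_inv)
  qed
  have \<tau>: "ok x y (\<tau> x y)" if "good x y" for x y
  proof -
    consider "idx x < idx y" | "idx y < idx x" | "idx x = idx y" by linarith
    then show ?thesis
    proof cases
      case 3
      then have "x = y" using that assms(1) by (auto simp: good_def idx_def)
      then show ?thesis by (simp add: \<tau>_def ok_def)
    qed (use \<tau>0[OF that] ok_inv[OF \<tau>0[OF sym[OF that]]] in \<open>auto simp: \<tau>_def\<close>)
  qed
  have "\<tau> y x \<circ> \<tau> x y = id" if "good x y" for x y
    using \<tau>0[OF that] \<tau>0[OF sym[OF that]]
    by (auto simp: \<tau>_def ok_def bij_is_inj surj_iff[THEN iffD1, OF bij_is_surj])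
  then show thesis
    using \<tau> by (intro that[of \<tau>]) (auto simp: good_def ok_def)
qed

section \<open>Holonomy\<close>

text \<open>
  Here \<open>\<tau> u v\<close> carries the fibre over \<open>u\<close> to the fibre over an adjacent vertex \<open>v\<close>.
\<close>

primrec holonomy :: "('a, 'b) pre_digraph \<Rightarrow> ('a \<Rightarrow> 'a \<Rightarrow> 'c \<Rightarrow> 'c) \<Rightarrow> 'b list \<Rightarrow> 'c \<Rightarrow> 'c" where
  "holonomy G \<tau> [] = id"
| "holonomy G \<tau> (e # p) = holonomy G \<tau> p \<circ> \<tau> (tail G e) (head G e)"

lemma holonomy_append: "holonomy G \<tau> (p @ q) = holonomy G \<tau> q \<circ> holonomy G \<tau> p"
  by (induction p) (simp_all add: o_assoc)

lemma holonomy_bij: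
  assumes "\<And>e. e \<in> set p \<Longrightarrow> bij (\<tau> (tail G e) (head G e))"
  shows "bij (holonomy G \<tau> p)"
  using assms by (induction p) (auto intro!: bij_comp)

text \<open>
  A closed walk which is not a cycle contains a shorter closed walk whose removal leaves a closed
  walk, and both have trivial holonomy by induction. A cycle shorter than the girth has length 2,
  hence runs along an edge and back.
\<close>

lemma (in graph) holonomy_short_closed_walk:
  assumes inv: "\<And>e. e \<in> arcs G \<Longrightarrow> \<tau> (head G e) (tail G e) \<circ> \<tau> (tail G e) (head G e) = id"
    and "awalk u p u" "enat (length p) < girth G"
  shows "holonomy G \<tau> p = id"
  using assms(2,3)
proof (induction "length p" arbitrary: u p rule: less_induct)
  case less
  show ?case
  proof (cases p)
    case (Cons e p')
    have e: "e \<in> arcs G" "tail G e = u" and p': "awalk (head G e) p' u"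
      using less.prems(1) Cons by (auto simp: awalk_Cons_iff)
    show ?thesis
    proof (cases "distinct (awalk_verts (head G e) p')")
      case True
      then have "cycle p"
        unfolding cycle_def using less.prems(1) Cons by (intro exI[of _ u]) simp
      then have "girth G \<le> enat (length p)" if "3 \<le> length p"
        using that unfolding girth_def by (intro INF_lower) simp
      then have "length p < 3" using less.prems(2) by (meson leD not_le_imp_less)
      moreover have "p' \<noteq> []" using p' e no_loops[of e] by (auto simp: awalk_Nil_iff)
      ultimately obtain f where f: "p' = [f]" using Cons by (cases p'; cases "tl p'") auto
      then have "tail G f = head G e" "head G f = tail G e"
        using p' e by (auto simp: awalk_Cons_iff awalk_Nil_iff)
      then show ?thesis using inv[OF e(1)] Cons f by simp
    next
      case False
      obtain q r s w where d: "p' = q @ r @ s" "0 < length r"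
        "awalk (head G e) q w" "awalk w r w" "awalk w s u"
        using awalk_not_distinct_decomp[OF p' False] by blast
      have lt: "enat (length l) < girth G" if "length l < length p" for l :: "'b list"
        using that less.prems(2) by (meson enat_ord_simps(2) less_trans)
      have eq: "awalk u ((e # q) @ s) u"
        using d e by (intro awalk_appendI[of _ _ w]) (auto simp: awalk_Cons_iff)
      have "holonomy G \<tau> r = id"
        using Cons d by (intro less.hyps[OF _ d(4)] lt) auto
      moreover have "holonomy G \<tau> ((e # q) @ s) = id"
        using Cons d by (intro less.hyps[OF _ eq] lt) auto
      ultimately show ?thesis unfolding Cons d(1) by (simp add: holonomy_append)
    qed
  qed simp
qed

text \<open>The triangle inequality along a walk.\<close>

lemma (in graph) l1_dist_holonomy_le:
  fixes c :: "'a \<Rightarrow> 'n \<Rightarrow> 'z \<Rightarrow> real"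
  assumes "\<And>e n. e \<in> arcs G \<Longrightarrow>
      (\<Sum>z\<in>Z. \<bar>c (tail G e) n z - c (head G e) (\<tau> (tail G e) (head G e) n) z\<bar>) \<le> b"
    and "awalk u p v"
  shows "(\<Sum>z\<in>Z. \<bar>c u n z - c v (holonomy G \<tau> p n) z\<bar>) \<le> b * real (length p)"
  using assms(2)
proof (induction p arbitrary: u n)
  case (Cons e p)
  let ?w = "head G e" and ?m = "\<tau> (tail G e) (head G e) n"
  have e: "e \<in> arcs G" "tail G e = u" "awalk ?w p v" using Cons.prems by (auto simp: awalk_Cons_iff)
  have "(\<Sum>z\<in>Z. \<bar>c u n z - c v (holonomy G \<tau> p ?m) z\<bar>)
      \<le> (\<Sum>z\<in>Z. \<bar>c u n z - c ?w ?m z\<bar> + \<bar>c ?w ?m z - c v (holonomy G \<tau> p ?m) z\<bar>)"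
    by (intro sum_mono) linarith
  also have "\<dots> \<le> b + b * real (length p)"
    using assms(1)[OF e(1), of n] Cons.IH[OF e(3), of ?m] e(2) by (simp add: sum.distrib)
  finally show ?case by (simp add: algebra_simps)
qed (auto simp: awalk_Nil_iff)

section \<open>Balls and cycles in graphs of bounded degree\<close>

lemma (in graph) card_walk_ball_le:
  assumes deg: "\<And>v. v \<in> verts G \<Longrightarrow> out_degree G v \<le> D"
  shows "card {w. \<exists>p. awalk v p w \<and> length p \<le> n} \<le> Suc D ^ n"
proof (induction n)
  case 0
  have "{w. \<exists>p. awalk v p w \<and> length p \<le> 0} \<subseteq> {v}" by (auto simp: awalk_Nil_iff)
  then have "card {w. \<exists>p. awalk v p w \<and> length p \<le> 0} \<le> card {v}" by (intro card_mono) auto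
  then show ?case by simp
next
  case (Suc n)
  let ?B = "\<lambda>n. {w. \<exists>p. awalk v p w \<and> length p \<le> n}"
  have inV: "?B n \<subseteq> verts G" by auto
  then have fin: "finite (?B n)" by (rule finite_subset) simp
  have "?B (Suc n) \<subseteq> ?B n \<union> (\<Union>w\<in>?B n. head G ` out_arcs G w)"
  proof
    fix w assume "w \<in> ?B (Suc n)"
    then obtain p where p: "awalk v p w" "length p \<le> Suc n" by blast
    show "w \<in> ?B n \<union> (\<Union>w\<in>?B n. head G ` out_arcs G w)"
    proof (cases p rule: rev_cases)
      case Nil
      then show ?thesis using p by force
    next
      case (snoc q e)
      then have "awalk v q (tail G e)" "e \<in> out_arcs G (tail G e)" "head G e = w" "length q \<le> n"
        using p by (auto simp: awalk_Cons_iff awalk_Nil_iff)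
      then show ?thesis by blast
    qed
  qed
  then have "card (?B (Suc n)) \<le> card (?B n \<union> (\<Union>w\<in>?B n. head G ` out_arcs G w))"
    using fin by (intro card_mono) auto
  also have "\<dots> \<le> card (?B n) + (\<Sum>w\<in>?B n. card (head G ` out_arcs G w))"
    using fin by (intro order_trans[OF card_Un_le] add_left_mono card_UN_le)
  also have "(\<Sum>w\<in>?B n. card (head G ` out_arcs G w)) \<le> card (?B n) * D"
  proof (rule sum_bounded_above[where K = D, simplified])
    fix w assume "w \<in> ?B n"
    then have "card (out_arcs G w) \<le> D" using deg inV by (auto simp: out_degree_def)
    then show "card (head G ` out_arcs G w) \<le> D"
      using card_image_le[OF finite_out_arcs, of "head G" w] by linarith
  qed
  also have "card (?B n) + card (?B n) * D = card (?B n) * Suc D" by simp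
  also have "\<dots> \<le> Suc D ^ n * Suc D" using Suc by (intro mult_right_mono) auto
  finally show ?case by (simp add: mult.commute)
qed

text \<open>
  Minimal degree 2 allows an infinite walk without backtracking. The segment between a
  vertex and its first repetition is a cycle; it is not a loop, and it has length at least 3
  because the walk does not backtrack.
\<close>

lemma (in graph) girth_le_card_verts:
  assumes deg: "\<And>v. v \<in> verts G \<Longrightarrow> 2 \<le> out_degree G v" and "verts G \<noteq> {}"
  shows "girth G \<le> enat (card (verts G))"
proof -
  have "\<exists>e'. e' \<in> arcs G \<and> tail G e' = head G e \<and> head G e' \<noteq> tail G e" if e: "e \<in> arcs G" for e
  proof -
    have "\<not> card (out_arcs G (head G e)) \<le> 1"
      using deg[of "head G e"] e by (simp add: out_degree_def)
    then obtain e1 e2 where e12: "e1 \<in> out_arcs G (head G e)" "e2 \<in> out_arcs G (head G e)" "e1 \<noteq> e2"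
      unfolding One_nat_def card_le_Suc0_iff_eq[OF finite_out_arcs] by blast
    then have "head G e1 \<noteq> head G e2"
      using no_multi_arcs[of e1 e2] by (auto simp: arc_to_ends_def)
    then show ?thesis using e12 by (cases "head G e1 = tail G e") auto
  qed
  then obtain nx where nx: "\<And>e. e \<in> arcs G \<Longrightarrow> nx e \<in> arcs G"
    "\<And>e. e \<in> arcs G \<Longrightarrow> tail G (nx e) = head G e"
    "\<And>e. e \<in> arcs G \<Longrightarrow> head G (nx e) \<noteq> tail G e" by metis
  \<comment> \<open>Iterating \<open>nx\<close> gives the walk with arcs \<open>f\<close> and vertices \<open>v\<close>.\<close>
  obtain v0 where "v0 \<in> verts G" using assms(2) by blast
  then have "out_arcs G v0 \<noteq> {}" using deg[of v0] by (auto simp: out_degree_def)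
  then obtain e0 where e0: "e0 \<in> arcs G" by auto
  define f where "f k = (nx ^^ k) e0" for k
  define v where "v k = tail G (f k)" for k
  have f: "f k \<in> arcs G" for k unfolding f_def by (induction k) (auto simp: e0 nx)
  have hd: "head G (f k) = v (Suc k)" for k using nx(2)[OF f[of k]] by (simp add: f_def v_def)
  have nb: "v (Suc (Suc k)) \<noteq> v k" for k
    using nx(3)[OF f[of k]] hd[of "Suc k"] by (simp add: f_def v_def)
  have nl: "v (Suc k) \<noteq> v k" for k using no_loops[OF f[of k]] by (simp add: hd v_def)
  have vV: "v k \<in> verts G" for k using f by (simp add: v_def)
  have walk: "awalk (v i) (map f [i..<i + k]) (v (i + k))" for i k
  proof (induction k)
    case (Suc k)
    have "awalk (v (i + k)) [f (i + k)] (v (i + Suc k))"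
      using f vV by (auto simp: awalk_Cons_iff awalk_Nil_iff hd) (simp add: v_def)
    with Suc show ?case by (simp add: awalk_appendI)
  qed (use vV in \<open>simp add: awalk_Nil_iff\<close>)
  have "\<not> inj_on v {..card (verts G)}"
  proof
    assume "inj_on v {..card (verts G)}"
    then have "card {..card (verts G)} \<le> card (verts G)"
      by (rule card_inj_on_le) (use vV in auto)
    then show False by simp
  qed
  then have ex: "\<exists>j. j \<le> card (verts G) \<and> (\<exists>i<j. v i = v j)"
    unfolding inj_on_def by (metis atMost_iff linorder_neqE_nat)
  \<comment> \<open>Minimality of \<open>j\<close> makes the vertices before \<open>j\<close> distinct.\<close>
  define j where "j = (LEAST j. \<exists>i<j. v i = v j)"
  have "\<exists>i<j. v i = v j"
    using LeastI_ex[of "\<lambda>j. \<exists>i<j. v i = v j"] ex unfolding j_def by blast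
  then obtain i where i: "i < j" "v i = v j" by blast
  have j_le: "j \<le> card (verts G)"
  proof -
    obtain k where k: "k \<le> card (verts G)" "\<exists>i<k. v i = v k" using ex by blast
    show ?thesis
      unfolding j_def by (rule order_trans[OF Least_le[of "\<lambda>j. \<exists>i<j. v i = v j", OF k(2)] k(1)])
  qed
  have least: "v a \<noteq> v b" if "a < b" "b < j" for a b
    using not_less_Least[of b "\<lambda>j. \<exists>i<j. v i = v j"] that unfolding j_def by blast
  define p where "p = map f [i..<j]"
  have p: "awalk (v i) p (v i)" using walk[of i "j - i"] i by (simp add: p_def)
  have "tl (awalk_verts (v i) p) = map (\<lambda>k. v (Suc k)) [i..<j]"
    using awalk_verts_conv'[of "v i" p "v i"] p i by (auto simp: awalk_def p_def hd)
  moreover have "inj_on (\<lambda>k. v (Suc k)) {i..<j}"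
  proof (rule linorder_inj_onI)
    fix a b assume ab: "a < b" "a \<in> {i..<j}" "b \<in> {i..<j}"
    show "v (Suc a) \<noteq> v (Suc b)"
    proof (cases "Suc b = j")
      case True
      then show ?thesis using least[of i "Suc a"] ab i by auto
    next
      case False
      then show ?thesis using least[of "Suc a" "Suc b"] ab by auto
    qed
  qed auto
  ultimately have "distinct (tl (awalk_verts (v i) p))" by (simp add: distinct_map)
  then have "cycle p" using p i by (auto simp: cycle_def p_def)
  moreover have "3 \<le> length p"
  proof -
    have "j \<noteq> Suc i" "j \<noteq> Suc (Suc i)" using nl[of i] nb[of i] i by metis+
    then show ?thesis using i by (simp add: p_def)
  qed
  ultimately have "girth G \<le> enat (length p)" unfolding girth_def by (intro INF_lower) simp
  also have "\<dots> \<le> enat (card (verts G))" using j_le by (simp add: p_def)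
  finally show ?thesis .
qed

section \<open>Permuting the coordinates of bounded sequences\<close>

definition reindex :: "(nat \<Rightarrow> nat) \<Rightarrow> linf \<Rightarrow> linf" where
  "reindex \<sigma> f = Bcontfun (\<lambda>n. apply_bcontfun f (\<sigma> n))"

lemma apply_reindex [simp]: "apply_bcontfun (reindex \<sigma> f) n = apply_bcontfun f (\<sigma> n)"
proof -
  have "(\<lambda>n. apply_bcontfun f (\<sigma> n)) \<in> bcontfun"
    by (rule bcontfun_normI[where b = "norm f"]) (use norm_bounded[of f] in auto)
  then show ?thesis by (simp add: reindex_def Bcontfun_inverse)
qed

lemma reindex_comp: "reindex \<sigma> \<circ> reindex \<rho> = reindex (\<rho> \<circ> \<sigma>)"
  by (auto intro!: ext bcontfun_eqI)

lemma reindex_id [simp]: "reindex id = id"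
  by (auto intro!: ext bcontfun_eqI)

lemma perm_isometry_reindex:
  assumes "bij \<sigma>"
  shows "perm_isometry (reindex \<sigma>)"
proof -
  have inv: "reindex (inv \<sigma>) \<circ> reindex \<sigma> = id" "reindex \<sigma> \<circ> reindex (inv \<sigma>) = id"
    using assms by (simp_all add: reindex_comp bij_is_inj surj_iff[THEN iffD1, OF bij_is_surj])
  have le: "norm (reindex \<rho> f) \<le> norm f" for \<rho> f
    by (rule norm_bound) (use norm_bounded[of f] in simp)
  have "norm (reindex \<sigma> f) = norm f" for f
    using le[of \<sigma> f] le[of "inv \<sigma>" "reindex \<sigma> f"] fun_cong[OF inv(1), of f] by simp
  moreover have "linear (reindex \<sigma>)"
    by (rule linearI) (auto intro!: bcontfun_eqI)
  moreover have "bij (reindex \<sigma>)" using o_bij[OF inv] .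
  ultimately show ?thesis using assms by (auto simp: perm_isometry_def)
qed

lemma apply_bcontfun_sum: "apply_bcontfun (\<Sum>z\<in>A. f z) n = (\<Sum>z\<in>A. apply_bcontfun (f z) n)"
  by (induction A rule: infinite_finite_induct) auto

text \<open>
  Quantifying over all finite sets avoids reference to the support, which depends on all
  coordinates at once. The empty set supplies \<open>0 \<le> b\<close> when the support is infinite and
  \<^const>\<open>norm_u\<close> takes its default value 0.
\<close>

lemma norm_u_le:
  assumes "\<And>n Z. finite Z \<Longrightarrow> (\<Sum>z\<in>Z. \<bar>apply_bcontfun (\<xi> z) n\<bar>) \<le> b"
  shows "norm_u M \<xi> \<le> b"
proof (cases "finite (linf_support M \<xi>)")
  case True
  show ?thesis
    unfolding norm_u_def
  proof (rule norm_bound)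
    fix n
    show "norm (apply_bcontfun (\<Sum>z\<in>linf_support M \<xi>. linf_abs (\<xi> z)) n) \<le> b"
      using assms[OF True, of n] by (simp add: apply_bcontfun_sum apply_linf_abs sum_nonneg)
  qed
next
  case False
  then show ?thesis using assms[of "{}"] by (simp add: norm_u_def)
qed

section \<open>Occupation measures of itineraries\<close>

definition occupation :: "'a metric \<Rightarrow> nat \<Rightarrow> 'a \<Rightarrow> 'a \<Rightarrow> linf" where
  "occupation M S x z = Bcontfun (\<lambda>n. real (count_list (itinerary M S x n) z) / real S)"

lemma apply_occupation:
  assumes "x \<in> mspace M"
  shows "apply_bcontfun (occupation M S x z) n = real (count_list (itinerary M S x n) z) / real S"
proof -
  have "real (count_list (itinerary M S x n) z) / real S \<le> 1" for n
    using itinerary_in[OF assms, of S n] count_le_length[of "itinerary M S x n" z]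
    by (cases "S = 0") (auto simp: itineraries_def)
  then have "(\<lambda>n. real (count_list (itinerary M S x n) z) / real S) \<in> bcontfun"
    by (intro bcontfun_normI[where b = 1]) auto
  then show ?thesis by (simp add: occupation_def Bcontfun_inverse)
qed

lemma set_itinerary:
  assumes "x \<in> mspace M"
  shows "set (itinerary M S x n) \<subseteq> mcball_of M x (real S)"
proof
  fix z assume "z \<in> set (itinerary M S x n)"
  then obtain k where k: "k < S" "z = itinerary M S x n ! k"
    using itinerary_in[OF assms, of S n] by (auto simp: itineraries_def in_set_conv_nth)
  then have "z \<in> mspace M" "mdist M x z \<le> real k"
    using itinerary_in[OF assms, of S n] by (auto simp: itineraries_def)
  then show "z \<in> mcball_of M x (real S)" using assms k(1) by (simp add: in_mcball_of)
qed

lemma linf_support_occupation: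
  assumes "x \<in> mspace M"
  shows "linf_support M (occupation M S x) \<subseteq> mcball_of M x (real S)"
proof
  fix z assume z: "z \<in> linf_support M (occupation M S x)"
  have "\<exists>n. z \<in> set (itinerary M S x n)"
  proof (rule ccontr)
    assume "\<nexists>n. z \<in> set (itinerary M S x n)"
    then have "occupation M S x z = 0"
      by (intro bcontfun_eqI) (simp add: apply_occupation[OF assms])
    then show False using z by (simp add: linf_support_def)
  qed
  then show "z \<in> mcball_of M x (real S)" using set_itinerary[OF assms] by blast
qed

lemma linf_prob_occupation:
  assumes x: "x \<in> mspace M" and fin: "finite (mcball_of M x (real S))" and "0 < S"
  shows "linf_prob M (occupation M S x)"
proof -
  let ?B = "mcball_of M x (real S)"
  have sub: "linf_support M (occupation M S x) \<subseteq> ?B" by (rule linf_support_occupation[OF x])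
  have "?B \<subseteq> mspace M" by auto
  then have "(\<Sum>z\<in>linf_support M (occupation M S x). occupation M S x z) = (\<Sum>z\<in>?B. occupation M S x z)"
    using sub fin by (intro sum.mono_neutral_left) (auto simp: linf_support_def)
  also have "\<dots> = const_bcontfun 1"
  proof (rule bcontfun_eqI)
    fix n
    have "(\<Sum>z\<in>?B. real (count_list (itinerary M S x n) z)) = real S"
      using sum_count_set[OF set_itinerary[OF x] fin, of n] itinerary_in[OF x, of S n]
      by (simp add: itineraries_def flip: of_nat_sum)
    then show "apply_bcontfun (\<Sum>z\<in>?B. occupation M S x z) n = apply_bcontfun (const_bcontfun 1) n"
      using \<open>0 < S\<close> by (simp add: apply_bcontfun_sum apply_occupation[OF x] flip: sum_divide_distrib)
  qed
  finally show ?thesis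
    using finite_subset[OF sub fin] by (simp add: linf_prob_def apply_occupation[OF x])
qed

section \<open>Coarse unions of connected graphs\<close>

locale connected_graphs =
  fixes X :: "nat \<Rightarrow> ('a, 'b) pre_digraph"
  assumes graph_X: "graph (X i)"
    and connected_X: "Digraph_Component.connected (X i)"
begin

abbreviation M :: "(nat \<times> 'a) metric" where
  "M \<equiv> coarse_union (\<lambda>i. graph_metric (X i))"

definition diam :: "nat \<Rightarrow> real" where
  "diam i = mdiam (graph_metric (X i)) (verts (X i))"

lemma finite_verts_X: "finite (verts (X i))"
proof -
  interpret graph "X i" by (rule graph_X)
  show ?thesis by simp
qed

lemma verts_X_nonempty: "verts (X i) \<noteq> {}"
  using connected_X[of i] by (auto simp: Digraph_Component.connected_def strongly_connected_def)

lemma mspace_M: "mspace M = (SIGMA i:UNIV. verts (X i))"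
  using mspace_coarse_union[of "\<lambda>i. graph_metric (X i)"]
  by (simp add: mspace_graph_metric graph_X connected_X finite_verts_X)

lemma mdist_M:
  "mdist M (i, x) (j, y) = (if i = j then graph_dist (X i) x y else max (diam i) (diam j) + 1)"
  using mdist_coarse_union[of "\<lambda>i. graph_metric (X i)"]
  by (simp add: mspace_graph_metric mdist_graph_metric graph_X connected_X finite_verts_X
      coarse_union_dist_def diam_def)

lemma countable_mspace_M: "countable (mspace M)"
  unfolding mspace_M by (intro countable_SIGMA countableI_type countable_finite finite_verts_X)

lemma diam_nonneg: "0 \<le> diam i"
  unfolding diam_def by (rule mdiam_nonneg[OF finite_verts_X])

lemma graph_dist_le_diam:
  "x \<in> verts (X i) \<Longrightarrow> y \<in> verts (X i) \<Longrightarrow> graph_dist (X i) x y \<le> diam i"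
  using mdist_le_mdiam[OF finite_verts_X, of x i y "graph_metric (X i)"]
  by (simp add: diam_def mdist_graph_metric graph_X connected_X)

lemma short_awalk:
  assumes "x \<in> verts (X i)" "y \<in> verts (X i)" "graph_dist (X i) x y \<le> r"
  obtains p where "pre_digraph.awalk (X i) x p y" "length p \<le> nat \<lfloor>r\<rfloor>"
proof -
  obtain p where p: "pre_digraph.awalk (X i) x p y" "graph_dist (X i) x y = real (length p)"
    using graph_dist_awalk[OF graph_X connected_X assms(1,2)] .
  have "length p \<le> nat \<lfloor>r\<rfloor>" using p(2) assms(3) by (simp add: le_nat_floor)
  with p(1) show thesis using that by blast
qed

lemma mdist_M_arc:
  assumes "e \<in> arcs (X i)"
  shows "(i, tail (X i) e) \<in> mspace M" "(i, head (X i) e) \<in> mspace M"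
    "mdist M (i, tail (X i) e) (i, head (X i) e) \<le> 1"
proof -
  interpret graph "X i" by (rule graph_X)
  have "awalk (tail (X i) e) [e] (head (X i) e)"
    using assms by (auto simp: awalk_Cons_iff awalk_Nil_iff)
  from graph_dist_le[OF this] show "mdist M (i, tail (X i) e) (i, head (X i) e) \<le> 1"
    by (simp add: mdist_M)
qed (use assms wf_digraph.wellformed[of "X i" e] graph_X[of i] in
    \<open>auto simp: mspace_M graph_def digraph_def fin_digraph_def\<close>)

lemma uniformly_discrete_M: "uniformly_discrete M"
  unfolding uniformly_discrete_def
proof (intro exI[of _ 1] conjI ballI impI)
  fix a b assume ab: "a \<in> mspace M" "b \<in> mspace M" and lt: "mdist M a b < 1"
  obtain i x j y where [simp]: "a = (i, x)" "b = (j, y)" by (cases a; cases b)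
  have "i = j" using lt diam_nonneg[of i] by (auto simp: mdist_M split: if_splits)
  then have "mdist M a b = 0" using lt by (simp add: mdist_M graph_dist_def)
  then show "a = b" using ab Metric_space.zero[OF Metric_space_mspace_mdist, of a M b] by simp
qed simp

text \<open>
  A ball of radius \<open>R\<close> consists of a ball in one graph, bounded by the number of short walks,
  and of points of graphs of diameter at most \<open>R\<close>, which are finitely many in total.
\<close>

lemma bounded_geometry_M:
  assumes deg: "\<And>i v. v \<in> verts (X i) \<Longrightarrow> out_degree (X i) v \<le> D"
    and diam: "\<And>r. finite {i. diam i \<le> r}"
  shows "bounded_geometry M"
  unfolding bounded_geometry_def
proof (intro allI impI)
  fix R :: real assume "0 \<le> R"
  define F where "F = (SIGMA i:{i. diam i \<le> R}. verts (X i))"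
  have F: "finite F" unfolding F_def using diam finite_verts_X by auto
  have "finite (mcball_of M a R) \<and> card (mcball_of M a R) \<le> Suc D ^ nat \<lfloor>R\<rfloor> + card F"
    if a: "a \<in> mspace M" for a
  proof -
    obtain i x where ax: "a = (i, x)" by (cases a)
    interpret graph "X i" by (rule graph_X)
    define B where "B = {w. \<exists>p. awalk x p w \<and> length p \<le> nat \<lfloor>R\<rfloor>}"
    have B: "finite B" "card B \<le> Suc D ^ nat \<lfloor>R\<rfloor>"
      unfolding B_def using card_walk_ball_le[OF deg]
      by (auto intro: finite_subset[OF _ finite_verts_X[of i]])
    have sub: "mcball_of M a R \<subseteq> Pair i ` B \<union> F"
    proof
      fix b assume b: "b \<in> mcball_of M a R"
      obtain j y where by': "b = (j, y)" by (cases b)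
      have V: "x \<in> verts (X i)" "y \<in> verts (X j)" and d: "mdist M a b \<le> R"
        using b by (auto simp: in_mcball_of mspace_M ax by')
      show "b \<in> Pair i ` B \<union> F"
      proof (cases "i = j")
        case True
        then obtain p where "awalk x p y" "length p \<le> nat \<lfloor>R\<rfloor>"
          using short_awalk[of x i y R] V d by (auto simp: mdist_M ax by')
        then show ?thesis using True by (auto simp: B_def by')
      next
        case False
        then show ?thesis using d V by (auto simp: F_def mdist_M ax by')
      qed
    qed
    have "card (mcball_of M a R) \<le> card (Pair i ` B \<union> F)"
      using sub B F by (intro card_mono) auto
    also have "\<dots> \<le> card (Pair i ` B) + card F" by (rule card_Un_le)
    also have "\<dots> \<le> card B + card F" using card_image_le[OF B(1)] by simp
    finally show ?thesis using finite_subset[OF sub] B F by simp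
  qed
  then show "\<exists>N. \<forall>x\<in>mspace M. finite (mcball_of M x R) \<and> card (mcball_of M x R) \<le> N" by blast
qed

lemma finite_girth_le:
  assumes "(\<lambda>i. girth (X i)) \<longlonglongrightarrow> \<infinity>"
  shows "finite {i. girth (X i) \<le> enat n}"
proof -
  have "eventually (\<lambda>i. enat n < girth (X i)) sequentially"
    using order_tendstoD(1)[OF assms] by simp
  then show ?thesis
    unfolding eventually_cofinite[symmetric] cofinite_eq_sequentially[symmetric]
    by (simp add: eventually_cofinite not_less)
qed

text \<open>
  A graph of diameter at most \<open>r\<close> is a single ball of radius \<open>r\<close>, so its number of vertices is
  bounded in terms of \<open>r\<close> and the maximal degree \<open>D\<close>; hence so is its girth.
\<close>

lemma finite_diam_le:
  assumes deg: "\<And>i v. v \<in> verts (X i) \<Longrightarrow> out_degree (X i) v \<le> D"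
    and deg2: "\<And>i v. v \<in> verts (X i) \<Longrightarrow> 2 \<le> out_degree (X i) v"
    and girth: "(\<lambda>i. girth (X i)) \<longlonglongrightarrow> \<infinity>"
  shows "finite {i. diam i \<le> r}"
proof (rule finite_subset[OF _ finite_girth_le[OF girth]])
  show "{i. diam i \<le> r} \<subseteq> {i. girth (X i) \<le> enat (Suc D ^ nat \<lfloor>r\<rfloor>)}"
  proof
    fix i assume "i \<in> {i. diam i \<le> r}"
    then have le: "diam i \<le> r" by simp
    interpret graph "X i" by (rule graph_X)
    obtain x where x: "x \<in> verts (X i)" using verts_X_nonempty by blast
    let ?B = "{w. \<exists>p. awalk x p w \<and> length p \<le> nat \<lfloor>r\<rfloor>}"
    have "verts (X i) \<subseteq> ?B"
    proof
      fix y assume y: "y \<in> verts (X i)"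
      then show "y \<in> ?B" using short_awalk[OF x y, of r] graph_dist_le_diam[OF x y] le by auto
    qed
    moreover have "finite ?B" by (rule finite_subset[OF _ finite_verts_X[of i]]) auto
    ultimately have "card (verts (X i)) \<le> card ?B" by (intro card_mono)
    also have "\<dots> \<le> Suc D ^ nat \<lfloor>r\<rfloor>" by (rule card_walk_ball_le[OF deg])
    finally have "girth (X i) \<le> enat (Suc D ^ nat \<lfloor>r\<rfloor>)"
      using girth_le_card_verts[OF deg2 verts_X_nonempty] by (meson enat_ord_simps(1) order_trans)
    then show "i \<in> {i. girth (X i) \<le> enat (Suc D ^ nat \<lfloor>r\<rfloor>)}" by simp
  qed
qed

section \<open>Local trivialisations by parallel transport\<close>

text \<open>
  The factor 3 accommodates the closed walks that lead from a base point to a point, on to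
  another point and back to the base point, each part having length at most \<open>L\<close>. The condition
  on the diameter excludes sets of diameter at most \<open>L\<close> that meet several graphs.
\<close>

definition exceptional :: "real \<Rightarrow> (nat \<times> 'a) set" where
  "exceptional L =
     (SIGMA i:{i. girth (X i) \<le> enat (3 * nat \<lfloor>L\<rfloor>) \<or> diam i \<le> L}. verts (X i))"

lemma exceptional_subset: "exceptional L \<subseteq> mspace M"
  by (auto simp: exceptional_def mspace_M)

lemma finite_exceptional:
  assumes "(\<lambda>i. girth (X i)) \<longlonglongrightarrow> \<infinity>" "\<And>r. finite {i. diam i \<le> r}"
  shows "finite (exceptional L)"
proof -
  have "{i. girth (X i) \<le> enat (3 * nat \<lfloor>L\<rfloor>) \<or> diam i \<le> L}
      = {i. girth (X i) \<le> enat (3 * nat \<lfloor>L\<rfloor>)} \<union> {i. diam i \<le> L}" by blast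
  then show ?thesis
    unfolding exceptional_def using finite_girth_le[OF assms(1)] assms(2) finite_verts_X by auto
qed

lemma sets_off_exceptional:
  assumes C: "C \<in> sets_off M (exceptional L) L" and "(i, x) \<in> C" "(j, y) \<in> C"
  shows "j = i" "x \<in> verts (X i)" "y \<in> verts (X i)" "graph_dist (X i) x y \<le> L"
    "enat (3 * nat \<lfloor>L\<rfloor>) < girth (X i)"
proof -
  have sub: "C \<subseteq> mspace M - exceptional L" and fin: "finite C" and L: "mdiam M C \<le> L"
    using C by (auto simp: sets_off_def)
  have d: "mdist M (i, x) (j, y) \<le> L" using mdist_le_mdiam[OF fin assms(2,3), of M] L by linarith
  have ij: "(i, x) \<in> mspace M - exceptional L" "(j, y) \<in> mspace M - exceptional L"
    using assms sub by auto
  then show eq: "j = i" using d by (auto simp: mdist_M exceptional_def mspace_M split: if_splits)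
  show "x \<in> verts (X i)" "y \<in> verts (X i)" "enat (3 * nat \<lfloor>L\<rfloor>) < girth (X i)"
    using ij eq by (auto simp: exceptional_def mspace_M)
  show "graph_dist (X i) x y \<le> L" using d eq by (simp add: mdist_M)
qed

text \<open>
  The permutation \<open>\<sigma> C x\<close> is the holonomy of a short walk from a base point of \<open>C\<close> to \<open>x\<close>. Passing
  from \<open>u\<close> to \<open>v\<close> along \<open>p\<close> is compatible with these choices because walks to \<open>u\<close>, along \<open>p\<close>, and
  back to the base point form a closed walk of length below the girth.
\<close>

lemma parallel_transport:
  fixes \<tau> :: "nat \<times> 'a \<Rightarrow> nat \<times> 'a \<Rightarrow> nat \<Rightarrow> nat"
  assumes bij: "\<And>x y. x \<in> mspace M \<Longrightarrow> y \<in> mspace M \<Longrightarrow> mdist M x y \<le> 1 \<Longrightarrow> bij (\<tau> x y)"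
    and inv: "\<And>x y. x \<in> mspace M \<Longrightarrow> y \<in> mspace M \<Longrightarrow> mdist M x y \<le> 1 \<Longrightarrow> \<tau> y x \<circ> \<tau> x y = id"
  obtains \<sigma> :: "(nat \<times> 'a) set \<Rightarrow> nat \<times> 'a \<Rightarrow> nat \<Rightarrow> nat" where
    "\<And>C x. C \<in> sets_off M (exceptional L) L \<Longrightarrow> x \<in> C \<Longrightarrow> bij (\<sigma> C x)"
    "\<And>C i u v p. C \<in> sets_off M (exceptional L) L \<Longrightarrow> (i, u) \<in> C \<Longrightarrow> (i, v) \<in> C \<Longrightarrow>
       pre_digraph.awalk (X i) u p v \<Longrightarrow> length p \<le> nat \<lfloor>L\<rfloor> \<Longrightarrow>
       \<sigma> C (i, v) = holonomy (X i) (\<lambda>a b. \<tau> (i, a) (i, b)) p \<circ> \<sigma> C (i, u)"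
proof -
  define hol where "hol i = holonomy (X i) (\<lambda>a b. \<tau> (i, a) (i, b))" for i
  define base where "base C = (SOME c. c \<in> C)" for C :: "(nat \<times> 'a) set"
  define path where
    "path C i v = (SOME p. pre_digraph.awalk (X i) (snd (base C)) p v \<and> length p \<le> nat \<lfloor>L\<rfloor>)" for C i v
  define \<sigma> where "\<sigma> C x = hol (fst x) (path C (fst x) (snd x))" for C x
  have base: "\<exists>b. base C = (i, b) \<and> (i, b) \<in> C"
    if "C \<in> sets_off M (exceptional L) L" "(i, v) \<in> C" for C i v
  proof -
    have "base C \<in> C" using that(2) unfolding base_def by (rule someI)
    then show ?thesis
      using sets_off_exceptional(1)[OF that, of "fst (base C)" "snd (base C)"]
      by (metis prod.collapse)
  qed
  have path: "pre_digraph.awalk (X i) (snd (base C)) (path C i v) v \<and> length (path C i v) \<le> nat \<lfloor>L\<rfloor>"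
    if C: "C \<in> sets_off M (exceptional L) L" "(i, v) \<in> C" for C i v
  proof -
    obtain b where b: "base C = (i, b)" "(i, b) \<in> C" using base[OF C] by blast
    have "\<exists>p. pre_digraph.awalk (X i) b p v \<and> length p \<le> nat \<lfloor>L\<rfloor>"
      using short_awalk[OF sets_off_exceptional(2-4)[OF C(1) b(2) C(2)]] by blast
    from someI_ex[OF this] show ?thesis by (simp add: path_def b(1))
  qed
  show thesis
  proof (rule that)
    fix C x assume C: "C \<in> sets_off M (exceptional L) L" "x \<in> C"
    obtain i v where x: "x = (i, v)" by (cases x)
    have "bij (hol i (path C i v))"
      unfolding hol_def
    proof (rule holonomy_bij)
      interpret graph "X i" by (rule graph_X)
      fix e assume "e \<in> set (path C i v)"
      then have "e \<in> arcs (X i)" using path[OF C(1), of i v] C(2) x by (auto simp: awalk_def)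
      then show "bij (\<tau> (i, tail (X i) e) (i, head (X i) e))" using mdist_M_arc by (intro bij)
    qed
    then show "bij (\<sigma> C x)" by (simp add: \<sigma>_def x)
  next
    fix C i u v p
    assume C: "C \<in> sets_off M (exceptional L) L" "(i, u) \<in> C" "(i, v) \<in> C"
      and p: "pre_digraph.awalk (X i) u p v" "length p \<le> nat \<lfloor>L\<rfloor>"
    interpret graph "X i" by (rule graph_X)
    obtain b where b: "base C = (i, b)" "(i, b) \<in> C" using base[OF C(1,2)] by blast
    let ?q = "path C i u" and ?r = "path C i v"
    have q: "awalk b ?q u" "length ?q \<le> nat \<lfloor>L\<rfloor>" using path[OF C(1,2)] b by auto
    have r: "awalk b ?r v" "length ?r \<le> nat \<lfloor>L\<rfloor>" using path[OF C(1,3)] b by auto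
    obtain s where s: "awalk v s b" "length s \<le> nat \<lfloor>L\<rfloor>"
      using sets_off_exceptional(2-4)[OF C(1) C(3) b(2)] short_awalk by blast
    have trivial: "hol i w = id" if "awalk z w z" "length w \<le> 3 * nat \<lfloor>L\<rfloor>" for z w
      unfolding hol_def
    proof (rule holonomy_short_closed_walk[OF _ that(1)])
      show "enat (length w) < girth (X i)"
        using sets_off_exceptional(5)[OF C(1,2,2)] that(2) by (meson enat_ord_simps(1) le_less_trans)
    qed (use mdist_M_arc in \<open>intro inv\<close>)
    \<comment> \<open>A return walk \<open>s\<close> closes up both \<open>?q @ p\<close> and \<open>?r\<close>, so its holonomy inverts both of theirs.\<close>
    have "awalk b (?q @ p @ s) b" "awalk v (s @ ?r) v"
      using q(1) r(1) s(1) p(1) by (meson awalk_appendI)+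
    then have "hol i (?q @ p @ s) = id" "hol i (s @ ?r) = id"
      using q(2) r(2) s(2) p(2) by (auto intro!: trivial)
    then have "hol i p \<circ> hol i ?q = hol i ?r"
      by (simp add: hol_def holonomy_append fun_eq_iff) metis
    then show "\<sigma> C (i, v) = holonomy (X i) (\<lambda>a b. \<tau> (i, a) (i, b)) p \<circ> \<sigma> C (i, u)"
      by (simp add: \<sigma>_def hol_def)
  qed
qed

text \<open>
  At each coordinate \<open>n\<close>, the itinerary of index \<open>\<sigma> n\<close> at \<open>u\<close> is compared with the one whose index
  is obtained by transport along \<open>p\<close>; every arc of \<open>p\<close> changes the
  occupation numbers by at most 2 in total.
\<close>

lemma reindexed_occupation_close:
  assumes S: "0 < S"
    and close: "\<And>x y n Z. x \<in> mspace M \<Longrightarrow> y \<in> mspace M \<Longrightarrow> mdist M x y \<le> 1 \<Longrightarrow> finite Z \<Longrightarrow>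
       (\<Sum>z\<in>Z. \<bar>real (count_list (itinerary M S x n) z)
             - real (count_list (itinerary M S y (\<tau> x y n)) z)\<bar>) \<le> 2"
    and p: "pre_digraph.awalk (X i) u p v"
    and \<sigma>: "\<sigma>' = holonomy (X i) (\<lambda>a b. \<tau> (i, a) (i, b)) p \<circ> \<sigma>"
  shows "norm_u M (\<lambda>z. reindex \<sigma> (occupation M S (i, u) z) - reindex \<sigma>' (occupation M S (i, v) z))
           \<le> 2 * real (length p) / real S"
proof (rule norm_u_le)
  fix n and Z :: "(nat \<times> 'a) set" assume Z: "finite Z"
  interpret graph "X i" by (rule graph_X)
  have uv: "(i, u) \<in> mspace M" "(i, v) \<in> mspace M" using p by (auto simp: mspace_M)
  define c where "c a m z = real (count_list (itinerary M S (i, a) m) z)" for a m z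
  have "(\<Sum>z\<in>Z. \<bar>apply_bcontfun (reindex \<sigma> (occupation M S (i, u) z)
            - reindex \<sigma>' (occupation M S (i, v) z)) n\<bar>)
      = (\<Sum>z\<in>Z. \<bar>c u (\<sigma> n) z - c v (\<sigma>' n) z\<bar>) / real S"
    using S by (simp add: apply_occupation uv c_def sum_divide_distrib flip: diff_divide_distrib)
  also have "(\<Sum>z\<in>Z. \<bar>c u (\<sigma> n) z - c v (\<sigma>' n) z\<bar>) \<le> 2 * real (length p)"
    unfolding \<sigma> comp_apply
  proof (rule l1_dist_holonomy_le[OF _ p])
    fix e m assume "e \<in> arcs (X i)"
    from close[OF mdist_M_arc[OF this] Z, of m]
    show "(\<Sum>z\<in>Z. \<bar>c (tail (X i) e) m z
        - c (head (X i) e) (\<tau> (i, tail (X i) e) (i, head (X i) e) m) z\<bar>) \<le> 2"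
      by (simp add: c_def)
  qed
  finally show "(\<Sum>z\<in>Z. \<bar>apply_bcontfun (reindex \<sigma> (occupation M S (i, u) z)
            - reindex \<sigma>' (occupation M S (i, v) z)) n\<bar>) \<le> 2 * real (length p) / real S"
    by (simp add: divide_right_mono)
qed

text \<open>
  The itineraries have length \<open>S \<ge> 2 R / \<epsilon>\<close>, and \<open>C\<close> is trivialised at \<open>x\<close> by reindexing along
  \<open>\<sigma> C x\<close>. Two such trivialisations of the points of \<open>C1 \<inter> C2\<close> change from \<open>x\<close> to \<open>y\<close> by the same
  factor \<open>h\<close>, which cancels in the transition isometry.
\<close>

lemma fibred_coarsely_amenable_M:
  assumes geo: "bounded_geometry M"
    and girth: "(\<lambda>i. girth (X i)) \<longlonglongrightarrow> \<infinity>"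
    and diam: "\<And>r. finite {i. diam i \<le> r}"
  shows "fibred_coarsely_amenable M"
  unfolding fibred_coarsely_amenable_def
proof (intro conjI allI impI uniformly_discrete_M geo)
  fix R \<epsilon> :: real assume "0 < R" "0 < \<epsilon>"
  obtain S where S: "2 * R / \<epsilon> < real S" using reals_Archimedean2 by blast
  moreover have "0 < 2 * R / \<epsilon>" using \<open>0 < R\<close> \<open>0 < \<epsilon>\<close> by simp
  ultimately have "0 < S" by linarith
  have SR: "2 * R / real S \<le> \<epsilon>"
    using S \<open>0 < S\<close> \<open>0 < \<epsilon>\<close> by (simp add: field_simps)
  obtain \<tau> where \<tau>:
    "\<And>x y. x \<in> mspace M \<Longrightarrow> y \<in> mspace M \<Longrightarrow> mdist M x y \<le> 1 \<Longrightarrow> bij (\<tau> x y)"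
    "\<And>x y. x \<in> mspace M \<Longrightarrow> y \<in> mspace M \<Longrightarrow> mdist M x y \<le> 1 \<Longrightarrow> \<tau> y x \<circ> \<tau> x y = id"
    "\<And>x y n Z. x \<in> mspace M \<Longrightarrow> y \<in> mspace M \<Longrightarrow> mdist M x y \<le> 1 \<Longrightarrow> finite Z \<Longrightarrow>
       (\<Sum>z\<in>Z. \<bar>real (count_list (itinerary M S x n) z)
             - real (count_list (itinerary M S y (\<tau> x y n)) z)\<bar>) \<le> 2"
    using itinerary_transport[OF countable_mspace_M \<open>0 < S\<close>] by blast
  let ?\<xi> = "occupation M S"
  have trivialisation: "\<exists>K. finite K \<and> K \<subseteq> mspace M \<and>
          (\<exists>t :: (nat \<times> 'a) set \<Rightarrow> nat \<times> 'a \<Rightarrow> linf \<Rightarrow> linf.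
            (\<forall>C\<in>sets_off M K L. \<forall>x\<in>C. perm_isometry (t C x)) \<and>
            (\<forall>C\<in>sets_off M K L. \<forall>x\<in>C. \<forall>y\<in>C. mdist M x y \<le> R \<longrightarrow>
               norm_u M (\<lambda>z. t C x (?\<xi> x z) - t C y (?\<xi> y z)) \<le> \<epsilon>) \<and>
            (\<forall>C\<^sub>1\<in>sets_off M K L. \<forall>C\<^sub>2\<in>sets_off M K L. \<forall>x\<in>C\<^sub>1 \<inter> C\<^sub>2. \<forall>y\<in>C\<^sub>1 \<inter> C\<^sub>2.
               t C\<^sub>1 x \<circ> inv (t C\<^sub>2 x) = t C\<^sub>1 y \<circ> inv (t C\<^sub>2 y)))" for L :: real
  proof -
    let ?K = "exceptional L"
    obtain \<sigma> :: "(nat \<times> 'a) set \<Rightarrow> nat \<times> 'a \<Rightarrow> nat \<Rightarrow> nat" where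
      \<sigma>_bij: "\<And>C x. C \<in> sets_off M ?K L \<Longrightarrow> x \<in> C \<Longrightarrow> bij (\<sigma> C x)" and
      \<sigma>_hol: "\<And>C i u v p. C \<in> sets_off M ?K L \<Longrightarrow> (i, u) \<in> C \<Longrightarrow> (i, v) \<in> C \<Longrightarrow>
       pre_digraph.awalk (X i) u p v \<Longrightarrow> length p \<le> nat \<lfloor>L\<rfloor> \<Longrightarrow>
       \<sigma> C (i, v) = holonomy (X i) (\<lambda>a b. \<tau> (i, a) (i, b)) p \<circ> \<sigma> C (i, u)"
      using parallel_transport[of \<tau> L, OF \<tau>(1,2)] by blast
    have perm: "perm_isometry (reindex (\<sigma> C x))" if "C \<in> sets_off M ?K L" "x \<in> C" for C x
      using that by (intro perm_isometry_reindex \<sigma>_bij)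
    have close: "norm_u M (\<lambda>z. reindex (\<sigma> C x) (?\<xi> x z) - reindex (\<sigma> C y) (?\<xi> y z)) \<le> \<epsilon>"
      if C: "C \<in> sets_off M ?K L" "x \<in> C" "y \<in> C" and d: "mdist M x y \<le> R" for C x y
    proof -
      obtain i u j v where xy: "x = (i, u)" "y = (j, v)" by (cases x; cases y)
      note off = sets_off_exceptional[OF C(1) C(2,3)[unfolded xy]]
      obtain p where p: "pre_digraph.awalk (X i) u p v" "graph_dist (X i) u v = real (length p)"
        using graph_dist_awalk[OF graph_X connected_X off(2,3)] .
      have "length p \<le> nat \<lfloor>L\<rfloor>" using off(4) p(2) by (simp add: le_nat_floor)
      then have hol: "\<sigma> C (i, v) = holonomy (X i) (\<lambda>a b. \<tau> (i, a) (i, b)) p \<circ> \<sigma> C (i, u)"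
        using C xy off(1) p(1) by (intro \<sigma>_hol) auto
      have "norm_u M (\<lambda>z. reindex (\<sigma> C x) (?\<xi> x z) - reindex (\<sigma> C y) (?\<xi> y z))
          \<le> 2 * real (length p) / real S"
        using reindexed_occupation_close[OF \<open>0 < S\<close> \<tau>(3) p(1) hol] xy off(1) by simp
      also have "\<dots> \<le> 2 * R / real S"
        using d off(1) p(2) xy \<open>0 < S\<close> by (intro divide_right_mono) (auto simp: mdist_M)
      also note SR
      finally show ?thesis .
    qed
    have cocycle: "reindex (\<sigma> C1 x) \<circ> inv (reindex (\<sigma> C2 x))
        = reindex (\<sigma> C1 y) \<circ> inv (reindex (\<sigma> C2 y))"
      if C: "C1 \<in> sets_off M ?K L" "C2 \<in> sets_off M ?K L" and x: "x \<in> C1 \<inter> C2" and y: "y \<in> C1 \<inter> C2"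
      for C1 C2 x y
    proof -
      obtain i u j v where xy: "x = (i, u)" "y = (j, v)" by (cases x; cases y)
      have in1: "(i, u) \<in> C1" "(j, v) \<in> C1" using x y xy by auto
      note off = sets_off_exceptional[OF C(1) in1]
      obtain p where p: "pre_digraph.awalk (X i) u p v" "length p \<le> nat \<lfloor>L\<rfloor>"
        using short_awalk[OF off(2-4)] .
      define h where "h = holonomy (X i) (\<lambda>a b. \<tau> (i, a) (i, b)) p"
      have \<sigma>: "\<sigma> C1 y = h \<circ> \<sigma> C1 x" "\<sigma> C2 y = h \<circ> \<sigma> C2 x"
        using \<sigma>_hol[OF C(1) _ _ p] \<sigma>_hol[OF C(2) _ _ p] x y xy off(1) by (auto simp: h_def)
      have bij: "bij (\<sigma> C2 x)" "bij (\<sigma> C2 y)" using \<sigma>_bij C(2) x y by auto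
      then have "bij (h \<circ> \<sigma> C2 x \<circ> inv (\<sigma> C2 x))"
        unfolding \<sigma>(2)[symmetric] by (intro bij_comp bij_imp_bij_inv)
      then have "bij h"
        using bij(1) by (simp add: comp_assoc surj_iff[THEN iffD1, OF bij_is_surj])
      then have bij': "bij (reindex h)" "bij (reindex (\<sigma> C2 x))"
        using perm_isometry_reindex bij(1) by (auto simp: perm_isometry_def)
      have "reindex (\<sigma> C1 y) \<circ> inv (reindex (\<sigma> C2 y))
          = reindex (\<sigma> C1 x) \<circ> (reindex h \<circ> inv (reindex h)) \<circ> inv (reindex (\<sigma> C2 x))"
        unfolding \<sigma> reindex_comp[symmetric] using bij' by (simp add: o_inv_distrib comp_assoc)
      then show ?thesis
        using bij'(1) by (simp add: surj_iff[THEN iffD1, OF bij_is_surj])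
    qed
    show ?thesis
      by (intro exI[of _ ?K] conjI exI[of _ "\<lambda>C x. reindex (\<sigma> C x)"] ballI impI
          finite_exceptional[OF girth diam] exceptional_subset perm close cocycle)
  qed
  have fin: "finite (mcball_of M x (real S))" if "x \<in> mspace M" for x
    using geo that unfolding bounded_geometry_def by (meson of_nat_0_le_iff)
  show "\<exists>S\<ge>0. \<exists>\<xi> :: nat \<times> 'a \<Rightarrow> nat \<times> 'a \<Rightarrow> linf.
        (\<forall>x\<in>mspace M. linf_support M (\<xi> x) \<subseteq> mcball_of M x S) \<and>
        (\<forall>x\<in>mspace M. linf_prob M (\<xi> x)) \<and>
        (\<forall>L\<ge>0. \<exists>K. finite K \<and> K \<subseteq> mspace M \<and>
          (\<exists>t :: (nat \<times> 'a) set \<Rightarrow> nat \<times> 'a \<Rightarrow> linf \<Rightarrow> linf.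
            (\<forall>C\<in>sets_off M K L. \<forall>x\<in>C. perm_isometry (t C x)) \<and>
            (\<forall>C\<in>sets_off M K L. \<forall>x\<in>C. \<forall>y\<in>C. mdist M x y \<le> R \<longrightarrow>
               norm_u M (\<lambda>z. t C x (\<xi> x z) - t C y (\<xi> y z)) \<le> \<epsilon>) \<and>
            (\<forall>C\<^sub>1\<in>sets_off M K L. \<forall>C\<^sub>2\<in>sets_off M K L. \<forall>x\<in>C\<^sub>1 \<inter> C\<^sub>2. \<forall>y\<in>C\<^sub>1 \<inter> C\<^sub>2.
               t C\<^sub>1 x \<circ> inv (t C\<^sub>2 x) = t C\<^sub>1 y \<circ> inv (t C\<^sub>2 y))))"
    by (intro exI[of _ "real S"] exI[of _ ?\<xi>] conjI ballI allI impI trivialisation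
        linf_support_occupation linf_prob_occupation fin \<open>0 < S\<close>) simp_all
qed

end

theorem theorem4p1:
  fixes X :: "nat \<Rightarrow> ('a, 'b) pre_digraph"
  assumes "\<And>i. graph (X i)"
    and "\<And>i. Digraph_Component.connected (X i)"
    and "\<exists>D. \<forall>i. \<forall>v\<in>verts (X i). out_degree (X i) v \<le> D"
    and "(\<lambda>i. girth (X i)) \<longlonglongrightarrow> \<infinity>"
    and "\<And>i v. v \<in> verts (X i) \<Longrightarrow> 2 \<le> out_degree (X i) v"
  shows "fibred_coarsely_amenable (coarse_union (\<lambda>i. graph_metric (X i)))"
proof -
  interpret connected_graphs X by (rule connected_graphs.intro) (rule assms)+
  obtain D where D: "\<And>i v. v \<in> verts (X i) \<Longrightarrow> out_degree (X i) v \<le> D"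
    using assms(3) by blast
  have diam: "finite {i. diam i \<le> r}" for r
    using D assms(5,4) by (rule finite_diam_le)
  show ?thesis
    using bounded_geometry_M[OF D diam] assms(4) diam by (rule fibred_coarsely_amenable_M)
qed

end
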